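(* The set $Z_{60}\subset\mathbb{P}^3$ has the unexpected cone property $\mathcal{C}(6)$. Moreover, for a general point $P\in\mathbb{P}^3$, the unexpected cone of degree $6$ with multiplicity $6$ at $P$ passing through all points of $Z_{60}$ is unique.
   Context: We work over $\mathbb{C}$. The Klein configuration $Z_{60}\subset\mathbb{P}^3=\mathbb{P}^3_{\mathbb{C}}$ (homogeneous coordinates $[x:y:z:w]$) is the following set of $60$ points: the $4$ coordinate points $[1:0:0:0],[0:1:0:0],[0:0:1:0],[0:0:0:1]$; the $24$ points having exactly two nonzero coordinates, the first nonzero coordinate being $1$ and the other one lying in $\{1,i,-1,-i\}$; and the $32$ points $[1:\pm1:\pm1:\pm1]$, $[1:\pm1:\pm i:\pm i]$, $[1:\pm i:\pm1:\pm i]$, $[1:\pm i:\pm i:\pm1]$ (all signs chosen independently). "General" means: in some nonempty Zariski open subset of the parameter space. Unexpected hypersurfaces: a reduced finite set of points $Z\subset\mathbb{P}^N$ admits an unexpected hypersurface of degree $d$ if there is a sequence of non-negative integers $m_1,\dots,m_s$ such that for general points $P_1,\dots,P_s$ the zero-dimensional subscheme $P=m_1P_1+\dots+m_sP_s$ fails to impose independent conditions on forms of degree $d$ vanishing along $Z$ and the set of such forms (vanishing along $Z$ and $P$) is non-empty, i.e. $$h^0(\mathbb{P}^N;\mathcal{O}_{\mathbb{P}^N}(d)\otimes I(Z)\otimes I(P))>\max\Big\{0,\;h^0(\mathbb{P}^N;\mathcal{O}_{\mathbb{P}^N}(d)\otimes I(Z))-\sum_{j=1}^s\binom{N+m_j-1}{N}\Big\}.$$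 Here the left-hand side is the dimension of the space of forms of degree $d$ vanishing at all points of $Z$ and vanishing to order at least $m_j$ at $P_j$ for each $j$. Unexpected cone property: a finite set $Z\subset\mathbb{P}^N$ has the unexpected cone property $\mathcal{C}(d)$, where $d$ is a positive integer, if for a general point $P\in\mathbb{P}^N$ there exists an unexpected hypersurface $S_P$ of degree $d$ and multiplicity $d$ at $P$ passing through all points of $Z$, where unexpected means (the case $s=1$, $m_1=d$, $P_1=P$ of the inequality defining unexpected hypersurfaces) that $$h^0(\mathbb{P}^N;\mathcal{O}_{\mathbb{P}^N}(d)\otimes I(Z)\otimes I(dP))>\max\Big\{0,\;h^0(\mathbb{P}^N;\mathcal{O}_{\mathbb{P}^N}(d)\otimes I(Z))-\binom{N+d-1}{N}\Big\},$$ the left-hand side being the dimension of the space of forms of degree $d$ vanishing at all points of $Z$ and vanishing to order at least $d$ at $P$. *)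

theory Defs
  imports "HOL-Analysis.Analysis" "HOL-Library.Poly_Mapping"
begin

text \<open>
  Polynomials over the complex numbers in variables indexed by the finite type \<open>'n\<close>:
  finitely supported families of coefficients, indexed by exponent vectors.  The homogeneous
  coordinates of \<open>N\<close>-dimensional projective space are indexed by \<open>'n\<close> with
  \<open>CARD('n) = N + 1\<close>.
\<close>

type_synonym 'n cpoly = "('n \<Rightarrow>\<^sub>0 nat) \<Rightarrow>\<^sub>0 complex"

definition cpoly_scale :: "complex \<Rightarrow> 'n cpoly \<Rightarrow> 'n cpoly" where
  "cpoly_scale c f = Poly_Mapping.single 0 c * f"

lemma vector_space_cpoly_scale: "vector_space (cpoly_scale :: complex \<Rightarrow> 'n cpoly \<Rightarrow> 'n cpoly)"
  by unfold_locales
    (simp_all add: cpoly_scale_def algebra_simps single_add mult_single flip: mult.assoc)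

definition cpoly_eval :: "('n::finite) cpoly \<Rightarrow> complex ^ 'n \<Rightarrow> complex" where
  "cpoly_eval f v = (\<Sum>m\<in>Poly_Mapping.keys f.
     Poly_Mapping.lookup f m * (\<Prod>i\<in>UNIV. (v $ i) ^ Poly_Mapping.lookup m i))"

definition forms :: "nat \<Rightarrow> ('n::finite) cpoly set" where
  "forms d = {f. \<forall>m\<in>Poly_Mapping.keys f. (\<Sum>i\<in>UNIV. Poly_Mapping.lookup m i) = d}"

text \<open>
  A point of projective space is the set of all its homogeneous coordinate vectors.
\<close>

definition proj_point :: "complex ^ 'n \<Rightarrow> (complex ^ 'n) set" where
  "proj_point v = {c *s v | c. c \<noteq> 0}"

definition proj_space :: "(complex ^ 'n) set set" where
  "proj_space = {proj_point v | v. v \<noteq> 0}"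

definition vanishes_at :: "('n::finite) cpoly \<Rightarrow> (complex ^ 'n) set \<Rightarrow> bool" where
  "vanishes_at f P \<longleftrightarrow> (\<forall>v\<in>P. cpoly_eval f v = 0)"

definition zariski_open :: "(complex ^ 'n::finite) set set \<Rightarrow> bool" where
  "zariski_open U \<longleftrightarrow> (\<exists>F \<subseteq> (\<Union>d. forms d).
     U = proj_space - {P \<in> proj_space. \<forall>f\<in>F. vanishes_at f P})"

definition for_general_point :: "((complex ^ 'n::finite) set \<Rightarrow> bool) \<Rightarrow> bool" where
  "for_general_point Q \<longleftrightarrow> (\<exists>U. zariski_open U \<and> U \<noteq> {} \<and> (\<forall>P\<in>U. Q P))"

definition point_ideal :: "(complex ^ 'n::finite) set \<Rightarrow> 'n cpoly set" where
  "point_ideal P = {f. vanishes_at f P}"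

text \<open>The span over the ring itself is the generated ideal.\<close>

primrec ideal_power :: "'a::comm_ring_1 set \<Rightarrow> nat \<Rightarrow> 'a set" where
  "ideal_power I 0 = UNIV"
| "ideal_power I (Suc m) = module.span times {a * b | a b. a \<in> I \<and> b \<in> ideal_power I m}"

text \<open>
  The forms of degree \<open>d\<close> vanishing along \<open>Z\<close> and to order at least \<open>m\<close> at \<open>P\<close>.  The fat point
  \<open>mP\<close> is the subscheme defined by the \<open>m\<close>-th power of the homogeneous ideal of \<open>P\<close>.  That ideal
  is generated by linearly independent linear forms, so its powers are saturated and no passage to
  the ideal sheaf is needed.
\<close>

definition forms_through :: "nat \<Rightarrow> (complex ^ 'n::finite) set set \<Rightarrow> 'n cpoly set" where
  "forms_through d Z = {f \<in> forms d. \<forall>P\<in>Z. vanishes_at f P}"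

definition forms_through_fat ::
    "nat \<Rightarrow> (complex ^ 'n::finite) set set \<Rightarrow> nat \<Rightarrow> (complex ^ 'n) set \<Rightarrow> 'n cpoly set" where
  "forms_through_fat d Z m P = forms_through d Z \<inter> ideal_power (point_ideal P) m"

text \<open>
  With \<open>N = CARD('n) - 1\<close>, the inequality expressing that forms of degree \<open>d\<close> through \<open>Z\<close> with
  multiplicity \<open>m\<close> at \<open>P\<close> are unexpected.  The right-hand side may be negative before taking the
  maximum, hence the integers.
\<close>

definition unexpected :: "nat \<Rightarrow> (complex ^ 'n::finite) set set \<Rightarrow> nat \<Rightarrow> (complex ^ 'n) set \<Rightarrow> bool"
  where
  "unexpected d Z m P \<longleftrightarrow>
     int (vector_space.dim cpoly_scale (forms_through_fat d Z m P)) >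
       max 0 (int (vector_space.dim cpoly_scale (forms_through d Z))
              - int (((CARD('n) - 1) + m - 1) choose (CARD('n) - 1)))"

text \<open>
  A hypersurface of degree \<open>d\<close> is a nonzero form of degree \<open>d\<close> up to nonzero scalars, that is, an
  effective divisor: non-reduced hypersurfaces are allowed and are distinguished from their support.
\<close>

definition hypersurface :: "'n cpoly \<Rightarrow> 'n cpoly set" where
  "hypersurface f = {cpoly_scale c f | c. c \<noteq> 0}"

text \<open>
  A nonzero form of degree \<open>d\<close> has multiplicity at most \<open>d\<close> at every point, so vanishing to order
  at least \<open>d\<close> means having multiplicity exactly \<open>d\<close>.
\<close>

definition unexpected_cones ::
    "nat \<Rightarrow> (complex ^ 'n::finite) set set \<Rightarrow> (complex ^ 'n) set \<Rightarrow> 'n cpoly set set" where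
  "unexpected_cones d Z P =
     {hypersurface f | f. f \<in> forms_through_fat d Z d P \<and> f \<noteq> 0 \<and> unexpected d Z d P}"

definition unexpected_cone_property :: "nat \<Rightarrow> (complex ^ 'n::finite) set set \<Rightarrow> bool" where
  "unexpected_cone_property d Z \<longleftrightarrow>
     d > 0 \<and> for_general_point (\<lambda>P. \<exists>S. S \<in> unexpected_cones d Z P)"

definition klein_coordinates :: "(complex ^ 4) set" where
  "klein_coordinates =
     {vector [1, 0, 0, 0], vector [0, 1, 0, 0], vector [0, 0, 1, 0], vector [0, 0, 0, 1]}
   \<union> (\<Union>a\<in>{1, \<i>, -1, -\<i>}.
       {vector [1, a, 0, 0], vector [1, 0, a, 0], vector [1, 0, 0, a],
        vector [0, 1, a, 0], vector [0, 1, 0, a], vector [0, 0, 1, a]})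
   \<union> {vector [1, a, b, c] | a b c. a \<in> {1, -1} \<and> b \<in> {1, -1} \<and> c \<in> {1, -1}}
   \<union> {vector [1, a, b, c] | a b c. a \<in> {1, -1} \<and> b \<in> {\<i>, -\<i>} \<and> c \<in> {\<i>, -\<i>}}
   \<union> {vector [1, a, b, c] | a b c. a \<in> {\<i>, -\<i>} \<and> b \<in> {1, -1} \<and> c \<in> {\<i>, -\<i>}}
   \<union> {vector [1, a, b, c] | a b c. a \<in> {\<i>, -\<i>} \<and> b \<in> {\<i>, -\<i>} \<and> c \<in> {1, -1}}"

definition klein_configuration :: "(complex ^ 4) set set" where
  "klein_configuration = proj_point ` klein_coordinates"

end

theory Submission
  imports Defs
begin

text \<open>
  The Klein coordinates \<open>x\<^sub>1, \<dots>, x\<^sub>6\<close> of a line, in which the Klein quadric is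
  \<open>x\<^sub>1\<^sup>2 + \<dots> + x\<^sub>6\<^sup>2 = 0\<close>, cancel in pairs \<open>x\<^sub>i\<^sup>2 = - x\<^sub>j\<^sup>2\<close> on the lines
  through a point of the Klein configuration.  So \<open>x\<^sub>1\<^sup>6 + \<dots> + x\<^sub>6\<^sup>6\<close>, evaluated on the line
  joining \<open>P\<close> to a variable point, is a sextic cone with vertex \<open>P\<close> through the configuration.

  A sextic with a point of multiplicity six at \<open>P = (1, a, b, c)\<close> is invariant under translation by
  \<open>P\<close>, hence determined by its restriction to the plane \<open>x = 0\<close>, a plane sextic through the
  projected points.  The difference of two suitably scaled such sextics has vanishing coefficient at
  \<open>z\<^sup>5w\<close>; the projected points then force it to be a multiple of a product of six lines, and the
  projection of \<open>(1, 1, 1, 1)\<close> lies on none of them.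

  Finally the \<open>28\<close> points with at most two nonzero coordinates already impose independent conditions
  on the \<open>84\<close>-dimensional space of sextics, so that the expected dimension is \<open>0\<close>.
\<close>

section \<open>Evaluation as a ring homomorphism\<close>

definition mono_eval :: "(('n::finite) \<Rightarrow>\<^sub>0 nat) \<Rightarrow> complex ^ 'n \<Rightarrow> complex" where
  "mono_eval m v = (\<Prod>i\<in>UNIV. (v $ i) ^ Poly_Mapping.lookup m i)"

lemma mono_eval_zero [simp]: "mono_eval 0 v = 1"
  by (simp add: mono_eval_def)

lemma mono_eval_add: "mono_eval (m + n) v = mono_eval m v * mono_eval n v"
  by (simp add: mono_eval_def lookup_add power_add prod.distrib)

lemma cpoly_eval_superset:
  assumes "finite S" "Poly_Mapping.keys f \<subseteq> S"
  shows "cpoly_eval f v = (\<Sum>m\<in>S. Poly_Mapping.lookup f m * mono_eval m v)"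
  unfolding cpoly_eval_def mono_eval_def using assms
  by (intro sum.mono_neutral_left) (auto simp: in_keys_iff)

lemma cpoly_eval_add [simp]: "cpoly_eval (f + g) v = cpoly_eval f v + cpoly_eval g v"
proof -
  let ?S = "Poly_Mapping.keys f \<union> Poly_Mapping.keys g"
  show ?thesis
    using keys_add[of f g]
    by (simp add: cpoly_eval_superset[of ?S] lookup_add algebra_simps sum.distrib)
qed

lemma cpoly_eval_zero [simp]: "cpoly_eval 0 v = 0"
  by (simp add: cpoly_eval_def)

lemma cpoly_eval_uminus [simp]: "cpoly_eval (- f) v = - cpoly_eval f v"
  using cpoly_eval_add[of f "- f" v] by (simp add: eq_neg_iff_add_eq_0 add.commute)

lemma cpoly_eval_diff [simp]: "cpoly_eval (f - g) v = cpoly_eval f v - cpoly_eval g v"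
  using cpoly_eval_add[of f "- g" v] by simp

lemma cpoly_eval_single [simp]: "cpoly_eval (Poly_Mapping.single m c) v = c * mono_eval m v"
  by (simp add: cpoly_eval_superset[of "{m}"])

lemma cpoly_eval_sum: "cpoly_eval (sum f S) v = (\<Sum>x\<in>S. cpoly_eval (f x) v)"
  by (induction S rule: infinite_finite_induct) auto

lemma poly_mapping_sum_singles:
  "f = (\<Sum>m\<in>Poly_Mapping.keys f. Poly_Mapping.single m (Poly_Mapping.lookup f m))"
  by (rule poly_mapping_eqI)
    (simp add: lookup_sum lookup_single when_def in_keys_iff)

lemma cpoly_eval_mult [simp]: "cpoly_eval (f * g) v = cpoly_eval f v * cpoly_eval g v"
proof -
  have "f * g = (\<Sum>m\<in>Poly_Mapping.keys f. \<Sum>n\<in>Poly_Mapping.keys g.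
      Poly_Mapping.single (m + n) (Poly_Mapping.lookup f m * Poly_Mapping.lookup g n))"
    by (subst (1) poly_mapping_sum_singles[of f], subst (1) poly_mapping_sum_singles[of g])
       (simp add: sum_product mult_single)
  then show ?thesis
    by (simp add: cpoly_eval_sum mono_eval_add cpoly_eval_superset[of "Poly_Mapping.keys f" f]
        cpoly_eval_superset[of "Poly_Mapping.keys g" g] sum_product mult_ac)
qed

lemma cpoly_eval_one [simp]: "cpoly_eval 1 v = 1"
  using cpoly_eval_single[of 0 1 v] by simp

lemma cpoly_eval_power [simp]: "cpoly_eval (f ^ k) v = cpoly_eval f v ^ k"
  by (induction k) auto

lemma cpoly_eval_scale [simp]: "cpoly_eval (cpoly_scale c f) v = c * cpoly_eval f v"
  by (simp add: cpoly_scale_def)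

lemma lookup_cpoly_scale [simp]:
  "Poly_Mapping.lookup (cpoly_scale c f) m = c * Poly_Mapping.lookup f m"
proof -
  have "cpoly_scale c f = (\<Sum>n\<in>Poly_Mapping.keys f. Poly_Mapping.single n (c * Poly_Mapping.lookup f n))"
    unfolding cpoly_scale_def
    by (subst (1) poly_mapping_sum_singles[of f]) (simp add: sum_distrib_left mult_single)
  then show ?thesis
    by (simp add: lookup_sum lookup_single when_def in_keys_iff)
qed

interpretation cpoly: vector_space "cpoly_scale :: complex \<Rightarrow> 'n cpoly \<Rightarrow> 'n cpoly"
  by (rule vector_space_cpoly_scale)

section \<open>Forms and their zeros at projective points\<close>

lemma forms_lookup_zero:
  "f \<in> forms d \<Longrightarrow> (\<Sum>i\<in>UNIV. Poly_Mapping.lookup m i) \<noteq> d \<Longrightarrow> Poly_Mapping.lookup f m = 0"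
  by (auto simp: forms_def in_keys_iff)

lemma subspace_forms: "cpoly.subspace (forms d)"
  unfolding cpoly.subspace_def forms_def
  by (auto simp: in_keys_iff lookup_add)

lemmas forms_add = cpoly.subspace_add[OF subspace_forms]
lemmas forms_diff = cpoly.subspace_diff[OF subspace_forms]

lemma forms_mult: "f \<in> forms d \<Longrightarrow> g \<in> forms e \<Longrightarrow> f * g \<in> forms (d + e)"
  using keys_mult[of f g] unfolding forms_def
  by (fastforce simp: lookup_add sum.distrib)

lemma one_in_forms: "1 \<in> forms 0"
  by (auto simp: forms_def)

lemma forms_power: "f \<in> forms d \<Longrightarrow> f ^ k \<in> forms (k * d)"
  by (induction k) (auto intro: forms_mult simp: one_in_forms)

lemma cpoly_eval_vector_scale:
  assumes "f \<in> forms d"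
  shows "cpoly_eval f (c *s v) = c ^ d * cpoly_eval f v"
proof -
  have "mono_eval m (c *s v) = c ^ d * mono_eval m v" if "m \<in> Poly_Mapping.keys f" for m
    using assms that
    by (auto simp: forms_def mono_eval_def power_mult_distrib prod.distrib power_sum)
  then show ?thesis
    by (simp add: cpoly_eval_superset[of "Poly_Mapping.keys f" f] sum_distrib_left mult_ac)
qed

lemma in_proj_point_self: "v \<in> proj_point v"
  unfolding proj_point_def by (auto intro!: exI[of _ 1])

lemma vanishes_at_proj_point:
  "f \<in> forms d \<Longrightarrow> vanishes_at f (proj_point v) \<longleftrightarrow> cpoly_eval f v = 0"
  using in_proj_point_self[of v]
  by (auto simp: vanishes_at_def proj_point_def cpoly_eval_vector_scale)

lemma proj_point_scale: "c \<noteq> 0 \<Longrightarrow> proj_point (c *s v) = proj_point v"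
  unfolding proj_point_def
proof safe
  fix d :: complex assume "c \<noteq> 0" "d \<noteq> 0"
  then show "\<exists>e. d *s (c *s v) = e *s v \<and> e \<noteq> 0"
    by (intro exI[of _ "d * c"]) simp
  show "\<exists>e. d *s v = e *s (c *s v) \<and> e \<noteq> 0"
    using \<open>c \<noteq> 0\<close> \<open>d \<noteq> 0\<close> by (intro exI[of _ "d / c"]) simp
qed

section \<open>Linear forms and powers of the ideal of a point\<close>

definition linear_form :: "complex ^ ('n::finite) \<Rightarrow> 'n cpoly" where
  "linear_form u = (\<Sum>i\<in>UNIV. Poly_Mapping.single (Poly_Mapping.single i 1) (u $ i))"

lemma cpoly_eval_linear_form [simp]:
  "cpoly_eval (linear_form u) v = (\<Sum>i\<in>UNIV. u $ i * v $ i)"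
proof -
  have "mono_eval (Poly_Mapping.single i 1) v = v $ i" for i
  proof -
    have "mono_eval (Poly_Mapping.single i 1) v = (\<Prod>j\<in>UNIV. if j = i then v $ j else 1)"
      unfolding mono_eval_def by (intro prod.cong) (auto simp: lookup_single when_def)
    then show ?thesis by simp
  qed
  then show ?thesis
    by (simp add: linear_form_def cpoly_eval_sum)
qed

lemma linear_form_in_forms:
  fixes u :: "complex ^ ('n::finite)"
  shows "linear_form u \<in> forms 1"
proof -
  have "Poly_Mapping.single (Poly_Mapping.single i 1) c \<in> forms 1" for i :: 'n and c
    by (auto simp: forms_def lookup_single when_def)
  then show ?thesis
    unfolding linear_form_def by (intro cpoly.subspace_sum subspace_forms) auto
qed

interpretation cpoly_ideal: module "(*) :: 'n cpoly \<Rightarrow> 'n cpoly \<Rightarrow> 'n cpoly"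
  by unfold_locales (simp_all add: algebra_simps)

lemma power_in_ideal_power: "f \<in> I \<Longrightarrow> f ^ m \<in> ideal_power I m"
  for f :: "'n cpoly"
  by (induction m) (auto intro!: cpoly_ideal.span_base)

lemma subspace_ideal_power: "cpoly_ideal.subspace (ideal_power I m)"
  for I :: "'n cpoly set"
  by (cases m) (simp_all)

lemma ideal_power_diff:
  "f \<in> ideal_power I m \<Longrightarrow> g \<in> ideal_power I m \<Longrightarrow> f - g \<in> ideal_power I m"
  for f g :: "'n cpoly"
  by (rule cpoly_ideal.subspace_diff[OF subspace_ideal_power])

lemma ideal_power_add:
  "f \<in> ideal_power I m \<Longrightarrow> g \<in> ideal_power I m \<Longrightarrow> f + g \<in> ideal_power I m"
  for f g :: "'n cpoly"
  by (rule cpoly_ideal.subspace_add[OF subspace_ideal_power])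

lemma ideal_power_scale: "f \<in> ideal_power I m \<Longrightarrow> cpoly_scale c f \<in> ideal_power I m"
  for f :: "'n cpoly"
  unfolding cpoly_scale_def by (rule cpoly_ideal.subspace_scale[OF subspace_ideal_power])

section \<open>Restriction to lines through a multiple point\<close>

lemma cpoly_eval_line_poly: "\<exists>q. \<forall>t. cpoly_eval f (p + t *s v) = poly q t"
proof (intro exI allI)
  fix t
  show "cpoly_eval f (p + t *s v) = poly (\<Sum>m\<in>Poly_Mapping.keys f.
      Polynomial.smult (Poly_Mapping.lookup f m)
        (\<Prod>i\<in>UNIV. [:p $ i, v $ i:] ^ Poly_Mapping.lookup m i)) t"
    by (simp add: cpoly_eval_def poly_sum poly_prod)
qed

text \<open>Restricting to a line is a ring homomorphism into polynomials in \<open>t\<close>, and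
  each element of the ideal of the point restricts to a multiple of \<open>t\<close>. As
  \<open>ideal_power\<close> is a span, the induction step shows that the polynomials divisible by
  \<open>t ^ Suc m\<close> along the line form an ideal \<open>T\<close> containing all the
  generating products.\<close>

lemma ideal_power_line:
  fixes f :: "('n::finite) cpoly"
  assumes "f \<in> ideal_power (point_ideal (proj_point p)) m"
  shows "\<exists>q. \<forall>t. cpoly_eval f (p + t *s v) = t ^ m * poly q t"
  using assms
proof (induction m arbitrary: f)
  case 0
  then show ?case using cpoly_eval_line_poly[of f p v] by simp
next
  case (Suc m)
  define T where "T = {f. \<exists>q. \<forall>t. cpoly_eval f (p + t *s v) = t ^ Suc m * poly q t}"
  have "cpoly_ideal.subspace T"
    unfolding cpoly_ideal.subspace_def T_def
  proof (safe, goal_cases)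
    case 1
    then show ?case by (auto intro: exI[of _ 0])
  next
    case (2 f g q r)
    then show ?case by (intro exI[of _ "q + r"]) (simp add: algebra_simps)
  next
    case (3 c f q)
    obtain r where "\<And>t. cpoly_eval c (p + t *s v) = poly r t"
      using cpoly_eval_line_poly by blast
    with 3 show ?case by (intro exI[of _ "r * q"]) (simp add: algebra_simps)
  qed
  moreover have "a * b \<in> T"
    if ab: "a \<in> point_ideal (proj_point p)" "b \<in> ideal_power (point_ideal (proj_point p)) m" for a b
  proof -
    obtain r where r: "\<And>t. cpoly_eval a (p + t *s v) = poly r t"
      using cpoly_eval_line_poly by blast
    have "poly r 0 = 0"
      using ab(1) r[of 0] in_proj_point_self[of p] by (auto simp: point_ideal_def vanishes_at_def)
    then obtain s where s: "r = [:0, 1:] * s"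
      using poly_eq_0_iff_dvd[of r 0] by (auto elim: dvdE)
    obtain q where "\<And>t. cpoly_eval b (p + t *s v) = t ^ m * poly q t"
      using Suc.IH[OF ab(2)] by blast
    then show ?thesis
      unfolding T_def by (auto simp: r s intro!: exI[of _ "s * q"])
  qed
  ultimately have "ideal_power (point_ideal (proj_point p)) (Suc m) \<subseteq> T"
    unfolding ideal_power.simps by (intro cpoly_ideal.span_minimal) auto
  with Suc.prems show ?case by (auto simp: T_def)
qed

text \<open>
  Along the line through \<open>p\<close> and \<open>v\<close> the form \<open>f\<close> equals a polynomial both in \<open>s\<close> and in \<open>1 / s\<close>.
\<close>

lemma cone_translation_invariant:
  fixes f :: "('n::finite) cpoly"
  assumes f: "f \<in> forms d" and I: "f \<in> ideal_power (point_ideal (proj_point p)) d"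
  shows "cpoly_eval f (v + s *s p) = cpoly_eval f v"
proof -
  obtain q where q: "\<And>t. cpoly_eval f (p + t *s v) = t ^ d * poly q t"
    using ideal_power_line[OF I] by blast
  obtain r where r: "\<And>t. cpoly_eval f (v + t *s p) = poly r t"
    using cpoly_eval_line_poly by blast
  have rq: "poly r t = poly q (inverse t)" if "t \<noteq> 0" for t
  proof -
    have "v + t *s p = t *s (p + inverse t *s v)"
      using that by (simp add: vec_eq_iff field_simps)
    then have "poly r t = t ^ d * (inverse t ^ d * poly q (inverse t))"
      by (metis r q cpoly_eval_vector_scale[OF f])
    then show ?thesis using that by (simp add: field_simps)
  qed
  \<comment> \<open>Multiplying r(t) = q(1/t) by a power of t clears the denominators. The exponent
    exceeds the degree of \<open>q\<close> by one, so that both sides also vanish at t = 0.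
    Comparing degrees then makes \<open>r\<close> constant.\<close>
  have "poly (monom 1 (Suc (degree q)) * r) t = poly ([:0, 1:] * reflect_poly q) t" for t
    by (cases "t = 0") (simp_all add: poly_monom rq poly_reflect_poly_nz)
  then have *: "monom 1 (Suc (degree q)) * r = [:0, 1:] * reflect_poly q"
    by (metis poly_eq_poly_eq_iff ext)
  have "degree r = 0"
  proof (cases "r = 0")
    case False
    then have "degree ([:0, 1:] * reflect_poly q) = Suc (degree q) + degree r"
      unfolding *[symmetric] by (subst degree_mult_eq) (auto simp: degree_monom_eq monom_eq_0_iff)
    moreover have "degree ([:0, 1:] * reflect_poly q) \<le> 1 + degree q"
      using degree_mult_le[of "[:0, 1:]" "reflect_poly q"] degree_reflect_poly_le[of q] by simp
    ultimately show ?thesis by simp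
  qed simp
  then have "poly r s = poly r 0"
    by (metis degree_eq_zeroE mult_zero_right poly_0 poly_pCons add_0_right)
  then show ?thesis using r[of s] r[of 0] by simp
qed

section \<open>Plane sextics with prescribed zeros\<close>

lemma i_powers: "\<i>^2 = -1" "\<i>^3 = - \<i>" "\<i>^4 = 1" "\<i>^5 = \<i>" "\<i>^6 = -1"
  by (simp_all add: eval_nat_numeral)

text \<open>The five roots are those of (x - a)^5 - (x - a), so the quintic is \<open>e5\<close>
  times this polynomial; the conclusions list its coefficients.\<close>

lemma quintic_five_roots:
  fixes a e0 e1 e2 e3 e4 e5 :: complex
  assumes "\<And>s. s \<in> {0, 1, -1, \<i>, -\<i>} \<Longrightarrow>
    e0 + e1 * (a + s) + e2 * (a + s)^2 + e3 * (a + s)^3 + e4 * (a + s)^4 + e5 * (a + s)^5 = 0"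
  shows "e4 = - 5 * a * e5" "e3 = 10 * a^2 * e5" "e2 = - 10 * a^3 * e5"
    "e1 = (5 * a^4 - 1) * e5" "e0 = (a - a^5) * e5"
proof -
  \<comment> \<open>The quintic minus \<open>e5\<close> times (x - a)^5 - (x - a): degree at most 4,
    but five roots.\<close>
  define p where "p = [:e0 - (a - a^5) * e5, e1 - (5 * a^4 - 1) * e5, e2 + 10 * a^3 * e5,
    e3 - 10 * a^2 * e5, e4 + 5 * a * e5:]"
  have p: "poly p (a + s) = e0 + e1 * (a + s) + e2 * (a + s)^2 + e3 * (a + s)^3
      + e4 * (a + s)^4 + e5 * (a + s)^5 - e5 * (s^5 - s)" for s
    unfolding p_def poly_pCons poly_0 by algebra
  have pow: "s^5 - s = 0" if "s \<in> {0, 1, -1, \<i>, -\<i>}" for s :: complex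
    using that by (auto simp: i_powers)
  have "poly p x = 0" if x: "x \<in> (+) a ` {0, 1, -1, \<i>, -\<i>}" for x
  proof -
    obtain s where s: "x = a + s" "s \<in> {0, 1, -1, \<i>, -\<i>}" using x by blast
    show ?thesis unfolding s p using assms[OF s(2)] pow[OF s(2)] by simp
  qed
  then have roots: "(+) a ` {0, 1, -1, \<i>, -\<i>} \<subseteq> {x. poly p x = 0}"
    by blast
  have "card {0, 1, -1, \<i>, -\<i>} = 5"
    by (simp add: complex_eq_iff)
  then have card: "card ((+) a ` {0, 1, -1, \<i>, -\<i>}) = 5"
    by (subst card_image) auto
  have "p = 0"
  proof (rule ccontr)
    assume "p \<noteq> 0"
    then have "5 \<le> degree p"
      using card_mono[OF poly_roots_finite roots] card_poly_roots_bound[of p] card by simp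
    then show False by (simp add: p_def split: if_splits)
  qed
  then show "e4 = - 5 * a * e5" "e3 = 10 * a^2 * e5" "e2 = - 10 * a^3 * e5"
    "e1 = (5 * a^4 - 1) * e5" "e0 = (a - a^5) * e5"
    unfolding p_def by (simp_all add: eq_neg_iff_add_eq_0)
qed

text \<open>Divisibility by s^5 - s leaves one free scalar. In terms of equations, the four values
  are a discrete Fourier transform of the coefficients; exponents 1 and 5 agree modulo 4, so only
  the sum \<open>c1 + c5\<close> is seen.\<close>

lemma binary_sextic_six_roots:
  fixes c1 c2 c3 c4 c5 :: complex
  assumes "\<And>s. s \<in> {1, -1, \<i>, -\<i>} \<Longrightarrow> c1 * s + c2 * s^2 + c3 * s^3 + c4 * s^4 + c5 * s^5 = 0"
  shows "c4 = 0" "c3 = 0" "c2 = 0" "c5 = - c1"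
proof -
  have *: "c1 + c2 + c3 + c4 + c5 = 0" "- c1 + c2 - c3 + c4 - c5 = 0"
     "c1 * \<i> - c2 - c3 * \<i> + c4 + c5 * \<i> = 0" "- c1 * \<i> - c2 + c3 * \<i> + c4 - c5 * \<i> = 0"
    using assms[of 1] assms[of "-1"] assms[of \<i>] assms[of "-\<i>"]
    by (simp_all add: i_powers)
  show "c4 = 0" "c3 = 0" "c2 = 0" "c5 = - c1"
    using * by (auto simp: complex_eq_iff)
qed

text \<open>
  On each of the lines joining \<open>(a, b, c)\<close> to a coordinate point, \<open>g\<close> is a quintic with five known
  roots.  As the coefficient of \<open>z\<^sup>5w\<close> vanishes, these quintics vanish identically, so that \<open>g\<close> is
  a multiple of the product of the three lines and the three coordinate lines.
\<close>

lemma plane_sextic_eq_zero: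
  fixes a b c c12 c13 k300 k030 k003 k210 k201 k120 k021 k102 k012 k111 :: complex
    and g :: "complex \<Rightarrow> complex \<Rightarrow> complex \<Rightarrow> complex"
  assumes g: "\<And>y z w. g y z w = c12 * (y^5 * z - y * z^5) + c13 * (y^5 * w - y * w^5)
    + y * z * w * (k300 * y^3 + k030 * z^3 + k003 * w^3 + k210 * y^2 * z + k201 * y^2 * w
      + k120 * y * z^2 + k021 * z^2 * w + k102 * y * w^2 + k012 * z * w^2 + k111 * y * z * w)"
    and g1: "\<And>s. s \<in> {0, 1, -1, \<i>, -\<i>} \<Longrightarrow> g (a + s) b c = 0"
    and g2: "\<And>s. s \<in> {0, 1, -1, \<i>, -\<i>} \<Longrightarrow> g a (b + s) c = 0"
    and g3: "\<And>s. s \<in> {0, 1, -1, \<i>, -\<i>} \<Longrightarrow> g a b (c + s) = 0"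
    and g4: "g (1 - a) (1 - b) (1 - c) = 0"
    and nz: "a \<noteq> 0" "b \<noteq> 0" "c \<noteq> 0" "a^4 \<noteq> 1" "b \<noteq> 1" "c \<noteq> 1"
      "a \<noteq> b" "b \<noteq> c" "a \<noteq> c" "a^4 + b^4 \<noteq> c^4 + 1"
  shows "g y z w = 0"
proof -
  have "a \<noteq> 1" using nz(4) by auto
  \<comment> \<open>Along each line parallel to an axis through (a, b, c), \<open>g\<close> is
    sorted by powers of \<open>t\<close> to match the quintic lemma. The constant term here is 0
    because \<open>g\<close> has no terms in z and w alone.\<close>
  have 1: "0 + (- c12 * b^5 - c13 * c^5 + b * c * (k030 * b^3 + k021 * b^2 * c + k012 * b * c^2
        + k003 * c^3)) * t
      + (b * c * (k120 * b^2 + k111 * b * c + k102 * c^2)) * t^2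
      + (b * c * (k210 * b + k201 * c)) * t^3 + (b * c * k300) * t^4
      + (c12 * b + c13 * c) * t^5 = g t b c" for t
    unfolding g by algebra
  note q1 = quintic_five_roots[OF g1[folded 1]]
  have 2: "(c13 * (a^5 * c - a * c^5)) + (c12 * a^5 + a * c * (k300 * a^3 + k201 * a^2 * c + k102 * a * c^2
        + k003 * c^3)) * t
      + (a * c * (k210 * a^2 + k111 * a * c + k012 * c^2)) * t^2
      + (a * c * (k120 * a + k021 * c)) * t^3 + (a * c * k030) * t^4
      + (- c12 * a) * t^5 = g a t c" for t
    unfolding g by algebra
  note q2 = quintic_five_roots[OF g2[folded 2]]
  have 3: "(c12 * (a^5 * b - a * b^5)) + (c13 * a^5 + a * b * (k300 * a^3 + k210 * a^2 * b + k120 * a * b^2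
        + k030 * b^3)) * t
      + (a * b * (k201 * a^2 + k111 * a * b + k021 * b^2)) * t^2
      + (a * b * (k102 * a + k012 * b)) * t^3 + (a * b * k003) * t^4
      + (- c13 * a) * t^5 = g a b t" for t
    unfolding g by algebra
  note q3 = quintic_five_roots[OF g3[folded 3]]
  \<comment> \<open>A zero constant term forces the leading coefficient to vanish, since a - a^5 is
    nonzero.\<close>
  have "a * (a^4 - 1) * (c12 * b + c13 * c) = 0"
    using q1(5) by algebra
  then have c: "c12 * b + c13 * c = 0"
    using nz by simp
  have "a * c * (a^4 + b^4 - c^4 - 1) * c13 = 0"
    using q2(5) c by algebra
  moreover have "a^4 + b^4 - c^4 - 1 \<noteq> 0"
    using nz(10) by (simp add: algebra_simps)
  ultimately have "c13 = 0"
    using nz by simp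
  with c have "c12 = 0"
    using nz by simp
  note c0 = \<open>c12 = 0\<close> \<open>c13 = 0\<close>
  \<comment> \<open>The leading coefficients are now 0, so all three quintics vanish identically and
    each of their coefficients gives a linear relation between the \<open>k\<close>s.\<close>
  have k3: "k300 = 0" "k030 = 0" "k003 = 0"
    using q1(1) q2(1) q3(1) nz by (simp_all add: c0)
  have k: "k210 * b + k201 * c = 0" "k120 * a + k021 * c = 0" "k102 * a + k012 * b = 0"
    using q1(2) q2(2) q3(2) nz by (simp_all add: c0)
  have "b * c * (k021 * b^2 * c + k012 * b * c^2) = 0" "a * c * (k201 * a^2 * c + k102 * a * c^2) = 0"
    "a * b * (k210 * a^2 * b + k120 * a * b^2) = 0"
    using q1(4) q2(4) q3(4) by (simp_all add: c0 k3)
  then have "b^2 * c^2 * (k021 * b + k012 * c) = 0" "a^2 * c^2 * (k201 * a + k102 * c) = 0"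
    "a^2 * b^2 * (k210 * a + k120 * b) = 0"
    by (simp_all add: algebra_simps power2_eq_square)
  then have k': "k021 * b + k012 * c = 0" "k201 * a + k102 * c = 0" "k210 * a + k120 * b = 0"
    using nz by simp_all
  \<comment> \<open>The relations link the six remaining coefficients in a cycle, so one scalar
    determines them all: the factor in front of the product of six lines in \<open>g'\<close>. It is
    read off from y^3 z^2 w and carried around the cycle.\<close>
  define \<tau> where "\<tau> = k210 / (b * c^2)"
  have k210: "k210 = \<tau> * b * c^2"
    using nz by (simp add: \<tau>_def)
  have k201: "k201 = - \<tau> * b^2 * c"
  proof -
    have "c * (k201 + \<tau> * b^2 * c) = 0" using k(1) k210 by algebra
    then show ?thesis using nz by (simp add: eq_neg_iff_add_eq_0)
  qed
  have k102: "k102 = \<tau> * a * b^2"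
  proof -
    have "c * (k102 - \<tau> * a * b^2) = 0" using k'(2) k201 by algebra
    then show ?thesis using nz by simp
  qed
  have k012: "k012 = - \<tau> * a^2 * b"
  proof -
    have "b * (k012 + \<tau> * a^2 * b) = 0" using k(3) k102 by algebra
    then show ?thesis using nz by (simp add: eq_neg_iff_add_eq_0)
  qed
  have k021: "k021 = \<tau> * a^2 * c"
  proof -
    have "b * (k021 - \<tau> * a^2 * c) = 0" using k'(1) k012 by algebra
    then show ?thesis using nz by simp
  qed
  have k120: "k120 = - \<tau> * a * c^2"
  proof -
    have "a * (k120 + \<tau> * a * c^2) = 0" using k(2) k021 by algebra
    then show ?thesis using nz by (simp add: eq_neg_iff_add_eq_0)
  qed
  have "b * c * (k111 * b * c) = 0"
    using q1(3) unfolding c0 k120 k102 by algebra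
  then have k111: "k111 = 0"
    using nz by simp
  have g': "g y z w = \<tau> * (y * z * w * (b * w - c * z) * (c * y - a * w) * (a * z - b * y))" for y z w
    unfolding g c0 k3 k210 k201 k102 k012 k021 k120 k111 by algebra
  \<comment> \<open>At (1 - a, 1 - b, 1 - c) the lines through (a, b, c) take the values b - c, c -
    a and a - b.\<close>
  have "\<tau> * ((1 - a) * (1 - b) * (1 - c) * (b - c) * (c - a) * (a - b)) = 0"
    using g4 unfolding g' by algebra
  then have "\<tau> = 0"
    using nz \<open>a \<noteq> 1\<close> by simp
  then show ?thesis by (simp add: g')
qed

section \<open>Coefficients of forms in four variables\<close>

lemma prod_UNIV_4: "prod f (UNIV :: 4 set) = f 1 * f 2 * f 3 * f 4"
  unfolding UNIV_4 by (simp add: ac_simps)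

lemma vector_4 [simp]:
  "(vector [x, y, z, w] :: 'a::zero ^ 4) $ 1 = x"
  "(vector [x, y, z, w] :: 'a::zero ^ 4) $ 2 = y"
  "(vector [x, y, z, w] :: 'a::zero ^ 4) $ 3 = z"
  "(vector [x, y, z, w] :: 'a::zero ^ 4) $ 4 = w"
  unfolding vector_def by simp_all

definition exponent4 :: "nat \<Rightarrow> nat \<Rightarrow> nat \<Rightarrow> nat \<Rightarrow> 4 \<Rightarrow>\<^sub>0 nat" where
  "exponent4 i j k l = Poly_Mapping.single 1 i + Poly_Mapping.single 2 j
     + Poly_Mapping.single 3 k + Poly_Mapping.single 4 l"

lemma lookup_exponent4 [simp]:
  "Poly_Mapping.lookup (exponent4 i j k l) 1 = i"
  "Poly_Mapping.lookup (exponent4 i j k l) 2 = j"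
  "Poly_Mapping.lookup (exponent4 i j k l) 3 = k"
  "Poly_Mapping.lookup (exponent4 i j k l) 4 = l"
  by (simp_all add: exponent4_def lookup_add lookup_single)

lemma exponent4_lookup:
  "exponent4 (Poly_Mapping.lookup m 1) (Poly_Mapping.lookup m 2)
     (Poly_Mapping.lookup m 3) (Poly_Mapping.lookup m 4) = m"
proof (rule poly_mapping_eqI)
  fix i :: 4
  show "Poly_Mapping.lookup (exponent4 (Poly_Mapping.lookup m 1) (Poly_Mapping.lookup m 2)
     (Poly_Mapping.lookup m 3) (Poly_Mapping.lookup m 4)) i = Poly_Mapping.lookup m i"
    using UNIV_4 by (cases "i = 1 \<or> i = 2 \<or> i = 3 \<or> i = 4") auto
qed

definition coeff4 :: "4 cpoly \<Rightarrow> nat \<Rightarrow> nat \<Rightarrow> nat \<Rightarrow> nat \<Rightarrow> complex" where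
  "coeff4 f i j k l = Poly_Mapping.lookup f (exponent4 i j k l)"

lemma form_eq_zeroI:
  assumes f: "f \<in> forms d"
    and "\<And>i j k. i \<le> d \<Longrightarrow> j \<le> d - i \<Longrightarrow> k \<le> d - i - j \<Longrightarrow> coeff4 f i j k (d - i - j - k) = 0"
  shows "f = 0"
proof (rule poly_mapping_eqI)
  fix m :: "4 \<Rightarrow>\<^sub>0 nat"
  let ?e = "Poly_Mapping.lookup m"
  show "Poly_Mapping.lookup f m = Poly_Mapping.lookup 0 m"
  proof (cases "?e 1 + ?e 2 + ?e 3 + ?e 4 = d")
    case True
    then have "?e 4 = d - ?e 1 - ?e 2 - ?e 3" by simp
    moreover have "coeff4 f (?e 1) (?e 2) (?e 3) (d - ?e 1 - ?e 2 - ?e 3) = 0"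
      using True by (intro assms(2)) linarith+
    ultimately show ?thesis
      by (metis coeff4_def exponent4_lookup lookup_zero)
  next
    case False
    then show ?thesis
      using forms_lookup_zero[OF f, of m] by (simp add: sum_4)
  qed
qed

lemma cpoly_eval_form4:
  assumes f: "f \<in> forms d"
  shows "cpoly_eval f v = (\<Sum>i\<le>d. \<Sum>j\<le>d - i. \<Sum>k\<le>d - i - j.
    coeff4 f i j k (d - i - j - k) * ((v $ 1)^i * (v $ 2)^j * (v $ 3)^k * (v $ 4)^(d - i - j - k)))"
proof -
  let ?S = "Sigma {..d} (\<lambda>i. Sigma {..d - i} (\<lambda>j. {..d - i - j}))"
  let ?e = "\<lambda>(i, j, k). exponent4 i j k (d - i - j - k)"
  have inj: "inj_on ?e ?S"
    by (rule inj_on_inverseI[of _ "\<lambda>m. (Poly_Mapping.lookup m 1, Poly_Mapping.lookup m 2, Poly_Mapping.lookup m 3)"])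
       auto
  have "Poly_Mapping.keys f \<subseteq> ?e ` ?S"
  proof
    fix m assume "m \<in> Poly_Mapping.keys f"
    with f have m: "Poly_Mapping.lookup m 1 + Poly_Mapping.lookup m 2 + Poly_Mapping.lookup m 3
        + Poly_Mapping.lookup m 4 = d"
      by (simp add: forms_def sum_4)
    then have "Poly_Mapping.lookup m 4 = d - Poly_Mapping.lookup m 1 - Poly_Mapping.lookup m 2
        - Poly_Mapping.lookup m 3"
      by simp
    with m exponent4_lookup[of m] show "m \<in> ?e ` ?S"
      by (intro image_eqI[of _ _ "(Poly_Mapping.lookup m 1, Poly_Mapping.lookup m 2, Poly_Mapping.lookup m 3)"])
         (auto)
  qed
  then have "cpoly_eval f v = (\<Sum>m\<in>?e ` ?S. Poly_Mapping.lookup f m * mono_eval m v)"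
    by (intro cpoly_eval_superset) auto
  also have "\<dots> = (\<Sum>x\<in>?S. Poly_Mapping.lookup f (?e x) * mono_eval (?e x) v)"
    unfolding sum.reindex[OF inj] by simp
  also have "\<dots> = (\<Sum>(i, j, k)\<in>?S. coeff4 f i j k (d - i - j - k) *
      ((v $ 1)^i * (v $ 2)^j * (v $ 3)^k * (v $ 4)^(d - i - j - k)))"
    by (intro sum.cong) (auto simp: coeff4_def mono_eval_def prod_UNIV_4)
  finally show ?thesis
    by (simp add: sum.Sigma)
qed

text \<open>A form loses no coefficient when the last variable is set to 1. The other three are then
  peeled off one at a time, a complex polynomial function in one variable being zero only if its
  coefficients are.\<close>

lemma form_eq_zero_if_eval_eq_zero:
  assumes f: "f \<in> forms d" and z: "\<And>v :: complex ^ 4. cpoly_eval f v = 0"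
  shows "f = 0"
proof (rule form_eq_zeroI[OF f])
  fix i j k assume ijk: "i \<le> d" "j \<le> d - i" "k \<le> d - i - j"
  have 1: "(\<Sum>i\<le>d. (\<Sum>j\<le>d - i. (\<Sum>k\<le>d - i - j. coeff4 f i j k (d - i - j - k) * z^k) * y^j) * x^i) = 0"
    for x y z
    using z[of "vector [x, y, z, 1]"]
    by (simp add: cpoly_eval_form4[OF f] sum_distrib_left sum_distrib_right mult_ac)
  then have "(\<Sum>j\<le>d - i. (\<Sum>k\<le>d - i - j. coeff4 f i j k (d - i - j - k) * z^k) * y^j) = 0" for y z
    using ijk(1) polyfun_eq_0[of "\<lambda>i. \<Sum>j\<le>d - i. (\<Sum>k\<le>d - i - j. coeff4 f i j k (d - i - j - k) * z^k) * y^j" d]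
    by blast
  then have "(\<Sum>k\<le>d - i - j. coeff4 f i j k (d - i - j - k) * z^k) = 0" for z
    using ijk(2) polyfun_eq_0[of "\<lambda>j. \<Sum>k\<le>d - i - j. coeff4 f i j k (d - i - j - k) * z^k" "d - i"]
    by blast
  then show "coeff4 f i j k (d - i - j - k) = 0"
    using ijk(3) polyfun_eq_0[of "\<lambda>k. coeff4 f i j k (d - i - j - k)" "d - i - j"]
    by blast
qed

section \<open>Conditions imposed by the points with at most two nonzero coordinates\<close>

lemma sum_atMost_numeral:
  "sum f {..numeral n} = sum f {..pred_numeral n} + f (numeral n)" for f :: "nat \<Rightarrow> 'a::comm_monoid_add"
  by (simp add: numeral_eq_Suc)

lemma forms_through_klein_eval:
  assumes "f \<in> forms_through 6 klein_configuration" "q \<in> klein_coordinates"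
  shows "cpoly_eval f q = 0"
  using assms in_proj_point_self[of q]
  by (auto simp: forms_through_def klein_configuration_def vanishes_at_def)

lemma klein_coordinates_few_nonzero:
  "vector [1, 0, 0, 0] \<in> klein_coordinates" "vector [0, 1, 0, 0] \<in> klein_coordinates"
  "vector [0, 0, 1, 0] \<in> klein_coordinates" "vector [0, 0, 0, 1] \<in> klein_coordinates"
  "s \<in> {1, -1, \<i>, -\<i>} \<Longrightarrow> vector [1, s, 0, 0] \<in> klein_coordinates"
  "s \<in> {1, -1, \<i>, -\<i>} \<Longrightarrow> vector [1, 0, s, 0] \<in> klein_coordinates"
  "s \<in> {1, -1, \<i>, -\<i>} \<Longrightarrow> vector [1, 0, 0, s] \<in> klein_coordinates"
  "s \<in> {1, -1, \<i>, -\<i>} \<Longrightarrow> vector [0, 1, s, 0] \<in> klein_coordinates"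
  "s \<in> {1, -1, \<i>, -\<i>} \<Longrightarrow> vector [0, 1, 0, s] \<in> klein_coordinates"
  "s \<in> {1, -1, \<i>, -\<i>} \<Longrightarrow> vector [0, 0, 1, s] \<in> klein_coordinates"
  unfolding klein_coordinates_def by blast+

text \<open>Each edge of the coordinate tetrahedron contains six of the points: two vertices, and
  four whose coordinate ratio is a fourth root of unity. The vertices remove the pure powers; the
  other four points then leave a multiple of u^5 v - u v^5 on the edge.\<close>

lemma klein_two_variable_coeffs:
  assumes "f \<in> forms_through 6 klein_configuration"
  shows "coeff4 f 6 0 0 0 = 0" "coeff4 f 0 6 0 0 = 0" "coeff4 f 0 0 6 0 = 0" "coeff4 f 0 0 0 6 = 0"
    "coeff4 f 4 2 0 0 = 0" "coeff4 f 3 3 0 0 = 0" "coeff4 f 2 4 0 0 = 0" "coeff4 f 1 5 0 0 = - coeff4 f 5 1 0 0"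
    "coeff4 f 4 0 2 0 = 0" "coeff4 f 3 0 3 0 = 0" "coeff4 f 2 0 4 0 = 0" "coeff4 f 1 0 5 0 = - coeff4 f 5 0 1 0"
    "coeff4 f 4 0 0 2 = 0" "coeff4 f 3 0 0 3 = 0" "coeff4 f 2 0 0 4 = 0" "coeff4 f 1 0 0 5 = - coeff4 f 5 0 0 1"
    "coeff4 f 0 4 2 0 = 0" "coeff4 f 0 3 3 0 = 0" "coeff4 f 0 2 4 0 = 0" "coeff4 f 0 1 5 0 = - coeff4 f 0 5 1 0"
    "coeff4 f 0 4 0 2 = 0" "coeff4 f 0 3 0 3 = 0" "coeff4 f 0 2 0 4 = 0" "coeff4 f 0 1 0 5 = - coeff4 f 0 5 0 1"
    "coeff4 f 0 0 4 2 = 0" "coeff4 f 0 0 3 3 = 0" "coeff4 f 0 0 2 4 = 0" "coeff4 f 0 0 1 5 = - coeff4 f 0 0 5 1"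
proof -
  have f: "f \<in> forms 6" using assms by (simp add: forms_through_def)
  note eval = cpoly_eval_form4[OF f]
  note klein = forms_through_klein_eval[OF assms]
  have "coeff4 f 6 0 0 0 = cpoly_eval f (vector [1, 0, 0, 0])"
    "coeff4 f 0 6 0 0 = cpoly_eval f (vector [0, 1, 0, 0])"
    "coeff4 f 0 0 6 0 = cpoly_eval f (vector [0, 0, 1, 0])"
    "coeff4 f 0 0 0 6 = cpoly_eval f (vector [0, 0, 0, 1])"
    by (simp_all add: eval sum_atMost_numeral)
  then show pure: "coeff4 f 6 0 0 0 = 0" "coeff4 f 0 6 0 0 = 0" "coeff4 f 0 0 6 0 = 0" "coeff4 f 0 0 0 6 = 0"
    by (simp_all only: klein klein_coordinates_few_nonzero)
  have
    "coeff4 f 5 1 0 0 * s + coeff4 f 4 2 0 0 * s^2 + coeff4 f 3 3 0 0 * s^3 + coeff4 f 2 4 0 0 * s^4 + coeff4 f 1 5 0 0 * s^5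
       = cpoly_eval f (vector [1, s, 0, 0])"
    "coeff4 f 5 0 1 0 * s + coeff4 f 4 0 2 0 * s^2 + coeff4 f 3 0 3 0 * s^3 + coeff4 f 2 0 4 0 * s^4 + coeff4 f 1 0 5 0 * s^5
       = cpoly_eval f (vector [1, 0, s, 0])"
    "coeff4 f 5 0 0 1 * s + coeff4 f 4 0 0 2 * s^2 + coeff4 f 3 0 0 3 * s^3 + coeff4 f 2 0 0 4 * s^4 + coeff4 f 1 0 0 5 * s^5
       = cpoly_eval f (vector [1, 0, 0, s])"
    "coeff4 f 0 5 1 0 * s + coeff4 f 0 4 2 0 * s^2 + coeff4 f 0 3 3 0 * s^3 + coeff4 f 0 2 4 0 * s^4 + coeff4 f 0 1 5 0 * s^5
       = cpoly_eval f (vector [0, 1, s, 0])"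
    "coeff4 f 0 5 0 1 * s + coeff4 f 0 4 0 2 * s^2 + coeff4 f 0 3 0 3 * s^3 + coeff4 f 0 2 0 4 * s^4 + coeff4 f 0 1 0 5 * s^5
       = cpoly_eval f (vector [0, 1, 0, s])"
    "coeff4 f 0 0 5 1 * s + coeff4 f 0 0 4 2 * s^2 + coeff4 f 0 0 3 3 * s^3 + coeff4 f 0 0 2 4 * s^4 + coeff4 f 0 0 1 5 * s^5
       = cpoly_eval f (vector [0, 0, 1, s])"
    for s
    by (simp_all add: eval sum_atMost_numeral pure)
  then have
    "coeff4 f 5 1 0 0 * s + coeff4 f 4 2 0 0 * s^2 + coeff4 f 3 3 0 0 * s^3 + coeff4 f 2 4 0 0 * s^4 + coeff4 f 1 5 0 0 * s^5 = 0"
    "coeff4 f 5 0 1 0 * s + coeff4 f 4 0 2 0 * s^2 + coeff4 f 3 0 3 0 * s^3 + coeff4 f 2 0 4 0 * s^4 + coeff4 f 1 0 5 0 * s^5 = 0"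
    "coeff4 f 5 0 0 1 * s + coeff4 f 4 0 0 2 * s^2 + coeff4 f 3 0 0 3 * s^3 + coeff4 f 2 0 0 4 * s^4 + coeff4 f 1 0 0 5 * s^5 = 0"
    "coeff4 f 0 5 1 0 * s + coeff4 f 0 4 2 0 * s^2 + coeff4 f 0 3 3 0 * s^3 + coeff4 f 0 2 4 0 * s^4 + coeff4 f 0 1 5 0 * s^5 = 0"
    "coeff4 f 0 5 0 1 * s + coeff4 f 0 4 0 2 * s^2 + coeff4 f 0 3 0 3 * s^3 + coeff4 f 0 2 0 4 * s^4 + coeff4 f 0 1 0 5 * s^5 = 0"
    "coeff4 f 0 0 5 1 * s + coeff4 f 0 0 4 2 * s^2 + coeff4 f 0 0 3 3 * s^3 + coeff4 f 0 0 2 4 * s^4 + coeff4 f 0 0 1 5 * s^5 = 0"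
    if "s \<in> {1, -1, \<i>, -\<i>}" for s
    using that by (simp_all only: klein klein_coordinates_few_nonzero)
  note roots = binary_sextic_six_roots[OF this(1)] binary_sextic_six_roots[OF this(2)]
    binary_sextic_six_roots[OF this(3)] binary_sextic_six_roots[OF this(4)]
    binary_sextic_six_roots[OF this(5)] binary_sextic_six_roots[OF this(6)]
  show "coeff4 f 4 2 0 0 = 0" "coeff4 f 3 3 0 0 = 0" "coeff4 f 2 4 0 0 = 0" "coeff4 f 1 5 0 0 = - coeff4 f 5 1 0 0"
    "coeff4 f 4 0 2 0 = 0" "coeff4 f 3 0 3 0 = 0" "coeff4 f 2 0 4 0 = 0" "coeff4 f 1 0 5 0 = - coeff4 f 5 0 1 0"
    "coeff4 f 4 0 0 2 = 0" "coeff4 f 3 0 0 3 = 0" "coeff4 f 2 0 0 4 = 0" "coeff4 f 1 0 0 5 = - coeff4 f 5 0 0 1"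
    "coeff4 f 0 4 2 0 = 0" "coeff4 f 0 3 3 0 = 0" "coeff4 f 0 2 4 0 = 0" "coeff4 f 0 1 5 0 = - coeff4 f 0 5 1 0"
    "coeff4 f 0 4 0 2 = 0" "coeff4 f 0 3 0 3 = 0" "coeff4 f 0 2 0 4 = 0" "coeff4 f 0 1 0 5 = - coeff4 f 0 5 0 1"
    "coeff4 f 0 0 4 2 = 0" "coeff4 f 0 0 3 3 = 0" "coeff4 f 0 0 2 4 = 0" "coeff4 f 0 0 1 5 = - coeff4 f 0 0 5 1"
    by (simp_all only: roots)
qed

text \<open>A basis of \<open>V\<close> is carried to an independent set inside the span of
  \<open>W\<close>, so its size is at most that of \<open>W\<close>.\<close>

lemma (in vector_space) dim_le_card_if_injective:
  assumes T: "module_hom scale scale T" and V: "subspace V" and inj: "inj_on T V"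
    and W: "T ` V \<subseteq> span W" "finite W"
  shows "dim V \<le> card W"
proof -
  interpret T: module_hom scale scale T by fact
  interpret vector_space_pair scale scale ..
  obtain B where B: "B \<subseteq> V" "independent B" "card B = dim V"
    using basis_exists by metis
  have "span B \<subseteq> V"
    using B(1) V by (rule span_minimal)
  then have inj: "inj_on T (span B)"
    using inj inj_on_subset by blast
  then have "independent (T ` B)"
    using B(2) T.module_hom_axioms 
    by (intro linear_independent_injective_image) (simp_all add: linear_def module_hom_iff_linear)
  moreover have "T ` B \<subseteq> span W"
    using B(1) W(1) by blast
  ultimately have "card (T ` B) \<le> card W"
    using independent_span_bound[OF W(2)] by blast
  moreover have "card (T ` B) = card B"
    using inj span_superset[of B] inj_on_subset by (blast intro: card_image)
  ultimately show ?thesis using B(3) by simp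
qed

text \<open>Discarding all monomials with exponents outside \<open>K\<close> is a linear map that is
  injective on \<open>V\<close>, by \<open>z\<close> applied to differences. Its image lies in the
  span of the monomials of \<open>K\<close>.\<close>

lemma dim_le_card_exponents:
  fixes V :: "'n cpoly set"
  assumes V: "cpoly.subspace V" and K: "finite K"
    and z: "\<And>f. f \<in> V \<Longrightarrow> (\<And>m. m \<in> K \<Longrightarrow> Poly_Mapping.lookup f m = 0) \<Longrightarrow> f = 0"
  shows "cpoly.dim V \<le> card K"
proof -
  define T :: "'n cpoly \<Rightarrow> 'n cpoly"
    where "T f = (\<Sum>m\<in>K. Poly_Mapping.single m (Poly_Mapping.lookup f m))" for f
  have lookup_T: "Poly_Mapping.lookup (T f) m = (if m \<in> K then Poly_Mapping.lookup f m else 0)" for f m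
    using K by (simp add: T_def lookup_sum lookup_single when_def)
  have hom: "module_hom cpoly_scale cpoly_scale T"
    by unfold_locales (auto intro!: poly_mapping_eqI simp: lookup_T lookup_add)
  have "inj_on T V"
  proof (rule inj_onI)
    fix f g assume fg: "f \<in> V" "g \<in> V" "T f = T g"
    have "f - g = 0"
    proof (rule z)
      show "f - g \<in> V" using V fg by (simp add: cpoly.subspace_diff)
      show "Poly_Mapping.lookup (f - g) m = 0" if "m \<in> K" for m
        using lookup_T[of f m] lookup_T[of g m] fg(3) that by (simp add: lookup_minus)
    qed
    then show "f = g" by simp
  qed
  moreover have "T f \<in> cpoly.span ((\<lambda>m. Poly_Mapping.single m 1) ` K)" for f
  proof -
    have "Poly_Mapping.single m c = cpoly_scale c (Poly_Mapping.single m 1)" for m :: "'n \<Rightarrow>\<^sub>0 nat" and c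
      by (simp add: cpoly_scale_def mult_single)
    then show ?thesis unfolding T_def
      by (metis (no_types, lifting) cpoly.span_sum cpoly.span_scale cpoly.span_base imageI)
  qed
  ultimately have "cpoly.dim V \<le> card ((\<lambda>m. Poly_Mapping.single m (1 :: complex)) ` K)"
    using hom V K by (intro cpoly.dim_le_card_if_injective) auto
  also have "\<dots> \<le> card K" using K by (rule card_image_le)
  finally show ?thesis .
qed

lemma subspace_forms_through: "cpoly.subspace (forms_through d Z)"
  using subspace_forms[of d]
  by (auto simp: cpoly.subspace_def forms_through_def vanishes_at_def)

text \<open>
  The \<open>28\<close> points with at most two nonzero coordinates impose independent conditions on sextics:
  they determine the coefficients with exponents in \<open>D\<close> (the fourth exponent is left out) by the
  other ones.
\<close>

lemma dim_forms_through_klein: "cpoly.dim (forms_through 6 klein_configuration) \<le> 56"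
proof -
  define S :: "(nat \<times> nat \<times> nat) set"
    where "S = Sigma {..6} (\<lambda>i. Sigma {..6 - i} (\<lambda>j. {..6 - i - j}))"
  define D :: "(nat \<times> nat \<times> nat) set" where "D = {
    (6, 0, 0), (0, 6, 0), (0, 0, 6), (0, 0, 0), (4, 2, 0), (3, 3, 0), (2, 4, 0),
    (1, 5, 0), (4, 0, 2), (3, 0, 3), (2, 0, 4), (1, 0, 5), (4, 0, 0), (3, 0, 0),
    (2, 0, 0), (1, 0, 0), (0, 4, 2), (0, 3, 3), (0, 2, 4), (0, 1, 5), (0, 4, 0),
    (0, 3, 0), (0, 2, 0), (0, 1, 0), (0, 0, 4), (0, 0, 3), (0, 0, 2), (0, 0, 1)}"
  \<comment> \<open>The 84 - 28 = 56 sextic monomials whose coefficients stay free.\<close>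
  define K where "K = (\<lambda>(i, j, k). exponent4 i j k (6 - i - j - k)) ` (S - D)"
  have "card S = 84"
    by (simp add: S_def card_SigmaI sum_atMost_numeral)
  moreover have "D \<subseteq> S"
    by (simp add: D_def S_def)
  moreover have "card D = 28"
    by (simp add: D_def)
  moreover have "finite S"
    by (simp add: S_def)
  ultimately have S: "card (S - D) = 56" "finite (S - D)"
    by (simp_all add: card_Diff_subset finite_subset)
  have "cpoly.dim (forms_through 6 klein_configuration) \<le> card K"
  proof (rule dim_le_card_exponents[OF subspace_forms_through])
    show "finite K" using S by (simp add: K_def)
    fix f assume f: "f \<in> forms_through 6 klein_configuration"
      and K: "\<And>m. m \<in> K \<Longrightarrow> Poly_Mapping.lookup f m = 0"
    have z: "coeff4 f i j k (6 - i - j - k) = 0" if "(i, j, k) \<in> S - D" for i j k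
      unfolding coeff4_def using that by (intro K) (auto simp: K_def intro: rev_image_eqI)
    \<comment> \<open>One exponent per edge belongs to \<open>K\<close>; its vanishing kills the
      antisymmetric partner in \<open>D\<close>.\<close>
    have "coeff4 f 5 1 0 0 = 0" "coeff4 f 5 0 1 0 = 0" "coeff4 f 5 0 0 1 = 0"
      "coeff4 f 0 5 1 0 = 0" "coeff4 f 0 5 0 1 = 0" "coeff4 f 0 0 5 1 = 0"
      using z[of 5 1 0] z[of 5 0 1] z[of 5 0 0] z[of 0 5 1] z[of 0 5 0] z[of 0 0 5]
      by (simp_all add: S_def D_def)
    then have "\<forall>(i, j, k)\<in>D. coeff4 f i j k (6 - i - j - k) = 0"
      by (simp add: D_def klein_two_variable_coeffs[OF f, unfolded One_nat_def])
    with z have "coeff4 f i j k (6 - i - j - k) = 0" if "(i, j, k) \<in> S" for i j k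
      using that by blast
    with f show "f = 0"
      by (intro form_eq_zeroI[of f 6]) (simp_all add: forms_through_def S_def)
  qed
  also have "card K \<le> 56"
    unfolding K_def S(1)[symmetric] by (rule card_image_le[OF S(2)])
  finally show ?thesis .
qed

section \<open>The sextic cone\<close>

text \<open>
  The linear forms are, up to scalars, the six Klein coordinates of the line joining
  \<open>(1, a, b, c)\<close> to a variable point.
\<close>

definition klein_cone :: "complex \<Rightarrow> complex \<Rightarrow> complex \<Rightarrow> 4 cpoly" where
  "klein_cone a b c =
     linear_form (vector [-a, 1, -c, b]) ^ 6 - linear_form (vector [-a, 1, c, -b]) ^ 6
   + linear_form (vector [-b, c, 1, -a]) ^ 6 - linear_form (vector [-b, -c, 1, a]) ^ 6
   + linear_form (vector [-c, -b, a, 1]) ^ 6 - linear_form (vector [-c, b, -a, 1]) ^ 6"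

lemma cpoly_eval_klein_cone:
  "cpoly_eval (klein_cone a b c) (vector [x, y, z, w]) =
     (- a * x + y - c * z + b * w)^6 - (- a * x + y + c * z - b * w)^6
   + (- b * x + c * y + z - a * w)^6 - (- b * x - c * y + z + a * w)^6
   + (- c * x - b * y + a * z + w)^6 - (- c * x + b * y - a * z + w)^6"
  by (simp add: klein_cone_def sum_4)

text \<open>The subtracted forms are Klein coordinates up to a factor \<open>\<i>\<close>, whose
  sixth power is -1. The points are grouped by algebraic relations: \<open>s^4 = 1\<close> on the
  edges, and for points without zero coordinates the squares \<open>x^2\<close>, \<open>y^2\<close>,
  \<open>z^2\<close> are signs with product 1. Vanishing is then a polynomial identity modulo these
  relations.\<close>

lemma klein_cone_vanishes:
  assumes "q \<in> klein_coordinates"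
  shows "cpoly_eval (klein_cone a b c) q = 0"
proof -
  have two: "cpoly_eval (klein_cone a b c) (vector [1, s, 0, 0]) = 0"
    "cpoly_eval (klein_cone a b c) (vector [1, 0, s, 0]) = 0"
    "cpoly_eval (klein_cone a b c) (vector [1, 0, 0, s]) = 0"
    "cpoly_eval (klein_cone a b c) (vector [0, 1, s, 0]) = 0"
    "cpoly_eval (klein_cone a b c) (vector [0, 1, 0, s]) = 0"
    "cpoly_eval (klein_cone a b c) (vector [0, 0, 1, s]) = 0" if "s^4 = 1" for s
    unfolding cpoly_eval_klein_cone using that by algebra+
  have four: "cpoly_eval (klein_cone a b c) (vector [1, x, y, z]) = 0"
    if "x^2 = 1 \<and> y^2 = 1 \<and> z^2 = 1 \<or> x^2 = 1 \<and> y^2 = -1 \<and> z^2 = -1 \<or> 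
        x^2 = -1 \<and> y^2 = 1 \<and> z^2 = -1 \<or> x^2 = -1 \<and> y^2 = -1 \<and> z^2 = 1" for x y z
    using that unfolding cpoly_eval_klein_cone by (elim disjE conjE) algebra+
  show ?thesis
    using assms unfolding klein_coordinates_def
  proof (elim UnE, goal_cases)
    case 1
    then show ?case by (elim insertE emptyE) (simp_all add: cpoly_eval_klein_cone)
  next
    case 2
    then obtain s where "s \<in> {1, \<i>, -1, -\<i>}" and q: "q \<in> {vector [1, s, 0, 0], vector [1, 0, s, 0],
        vector [1, 0, 0, s], vector [0, 1, s, 0], vector [0, 1, 0, s], vector [0, 0, 1, s]}"
      by (elim UN_E) (rule that)
    then have "s^4 = 1" by auto
    with q two[of s] show ?case by blast
  next
    case 3
    then obtain x y z where "q = vector [1, x, y, z]" "x \<in> {1, -1}" "y \<in> {1, -1}" "z \<in> {1, -1}"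
      by (elim CollectE exE conjE) (rule that)
    then have "x^2 = 1" "y^2 = 1" "z^2 = 1" by auto
    with \<open>q = _\<close> four[of x y z] show ?case by simp
  next
    case 4
    then obtain x y z where "q = vector [1, x, y, z]" "x \<in> {1, -1}" "y \<in> {\<i>, -\<i>}" "z \<in> {\<i>, -\<i>}"
      by (elim CollectE exE conjE) (rule that)
    then have "x^2 = 1" "y^2 = -1" "z^2 = -1" by auto
    with \<open>q = _\<close> four[of x y z] show ?case by simp
  next
    case 5
    then obtain x y z where "q = vector [1, x, y, z]" "x \<in> {\<i>, -\<i>}" "y \<in> {1, -1}" "z \<in> {\<i>, -\<i>}"
      by (elim CollectE exE conjE) (rule that)
    then have "x^2 = -1" "y^2 = 1" "z^2 = -1" by auto
    with \<open>q = _\<close> four[of x y z] show ?case by simp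
  next
    case 6
    then obtain x y z where "q = vector [1, x, y, z]" "x \<in> {\<i>, -\<i>}" "y \<in> {\<i>, -\<i>}" "z \<in> {1, -1}"
      by (elim CollectE exE conjE) (rule that)
    then have "x^2 = -1" "y^2 = -1" "z^2 = 1" by auto
    with \<open>q = _\<close> four[of x y z] show ?case by simp
  qed
qed

lemma klein_cone_in_forms: "klein_cone a b c \<in> forms 6"
  unfolding klein_cone_def
  by (intro forms_add forms_diff forms_power[of _ 1 6, simplified] linear_form_in_forms[unfolded One_nat_def])

lemma linear_form_in_point_ideal:
  "(\<Sum>i\<in>UNIV. u $ i * v $ i) = 0 \<Longrightarrow> linear_form u \<in> point_ideal (proj_point v)"
  using vanishes_at_proj_point[OF linear_form_in_forms, of u v] by (simp add: point_ideal_def)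

text \<open>All six linear forms vanish at the vertex, so their sixth powers lie in the sixth power
  of its ideal.\<close>

lemma klein_cone_in_forms_through_fat:
  "klein_cone a b c \<in> forms_through_fat 6 klein_configuration 6 (proj_point (vector [1, a, b, c]))"
  (is "?f \<in> _")
proof -
  have "?f \<in> forms_through 6 klein_configuration"
    using klein_cone_in_forms klein_cone_vanishes
    by (auto simp: forms_through_def klein_configuration_def vanishes_at_proj_point[of _ 6])
  moreover have "?f \<in> ideal_power (point_ideal (proj_point (vector [1, a, b, c]))) 6"
    unfolding klein_cone_def
    by (intro ideal_power_add ideal_power_diff power_in_ideal_power linear_form_in_point_ideal)
       (simp_all add: sum_4)
  ultimately show ?thesis by (simp add: forms_through_fat_def)
qed

section \<open>Uniqueness of the cone\<close>

text \<open>On the line x = y = 0 the form is a multiple of z^5 w - z w^5, which equals -30 at (1,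
  2). So \<open>f0\<close> says exactly that the coefficient of z^5 w is zero, as the plane argument
  requires.\<close>

lemma klein_fat_form_eq_zero:
  assumes f: "f \<in> forms_through_fat 6 klein_configuration 6 (proj_point (vector [1, a, b, c]))"
    and f0: "cpoly_eval f (vector [0, 0, 1, 2]) = 0"
    and nz: "a \<noteq> 0" "b \<noteq> 0" "c \<noteq> 0" "a^4 \<noteq> 1" "b \<noteq> 1" "c \<noteq> 1"
      "a \<noteq> b" "b \<noteq> c" "a \<noteq> c" "a^4 + b^4 \<noteq> c^4 + 1"
  shows "f = 0"
proof -
  let ?p = "vector [1, a, b, c] :: complex ^ 4"
  have f6: "f \<in> forms 6" and fZ: "f \<in> forms_through 6 klein_configuration"
    and fI: "f \<in> ideal_power (point_ideal (proj_point ?p)) 6"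
    using f by (auto simp: forms_through_fat_def forms_through_def)
  note coeffs = klein_two_variable_coeffs[OF fZ, unfolded One_nat_def]
  \<comment> \<open>Translating by -x times the vertex is the projection from it to the plane x =
    0.\<close>
  have proj: "cpoly_eval f (vector [0, y - a * x, z - b * x, w - c * x]) = cpoly_eval f (vector [x, y, z, w])"
    for x y z w
  proof -
    have "vector [0, y - a * x, z - b * x, w - c * x] = vector [x, y, z, w] + (- x) *s ?p"
      by (simp add: vec_eq_iff forall_4 algebra_simps)
    then show ?thesis by (simp only: cone_translation_invariant[OF f6 fI])
  qed
  have "30 * coeff4 f 0 0 5 1 = - cpoly_eval f (vector [0, 0, 1, 2])"
    by (simp add: cpoly_eval_form4[OF f6] sum_atMost_numeral coeffs)
  then have c23: "coeff4 f 0 0 5 1 = 0" using f0 by simp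
  define g where "g y z w = cpoly_eval f (vector [0, y, z, w])" for y z w
  have g: "g y z w = coeff4 f 0 5 1 0 * (y^5 * z - y * z^5) + coeff4 f 0 5 0 1 * (y^5 * w - y * w^5)
    + y * z * w * (coeff4 f 0 4 1 1 * y^3 + coeff4 f 0 1 4 1 * z^3 + coeff4 f 0 1 1 4 * w^3
      + coeff4 f 0 3 2 1 * y^2 * z + coeff4 f 0 3 1 2 * y^2 * w + coeff4 f 0 2 3 1 * y * z^2
      + coeff4 f 0 1 3 2 * z^2 * w + coeff4 f 0 2 1 3 * y * w^2 + coeff4 f 0 1 2 3 * z * w^2
      + coeff4 f 0 2 2 2 * y * z * w)" for y z w
  proof -
    have "g y z w = coeff4 f 0 1 1 4 * (y * z * w^4) - coeff4 f 0 5 0 1 * (y * w^5)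
      + coeff4 f 0 1 2 3 * (y * z^2 * w^3) + coeff4 f 0 1 3 2 * (y * z^3 * w^2)
      + coeff4 f 0 1 4 1 * (y * z^4 * w) - coeff4 f 0 5 1 0 * (y * z^5)
      + coeff4 f 0 2 1 3 * (y^2 * z * w^3) + coeff4 f 0 2 2 2 * (y^2 * z^2 * w^2)
      + coeff4 f 0 2 3 1 * (y^2 * z^3 * w) + coeff4 f 0 3 1 2 * (y^3 * z * w^2)
      + coeff4 f 0 3 2 1 * (y^3 * z^2 * w) + coeff4 f 0 4 1 1 * (y^4 * z * w)
      + coeff4 f 0 5 0 1 * (y^5 * w) + coeff4 f 0 5 1 0 * (y^5 * z)"
      using c23 unfolding g_def
      by (simp add: cpoly_eval_form4[OF f6] sum_atMost_numeral coeffs)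
    then show ?thesis by algebra
  qed
  have g_proj: "g (y - a * x) (z - b * x) (w - c * x) = 0" if "vector [x, y, z, w] \<in> klein_coordinates" for x y z w
    using forms_through_klein_eval[OF fZ that] by (simp add: proj g_def)
  \<comment> \<open>The projection of (1, -s, 0, 0) is (-(a + s), -b, -c); the even degree absorbs
    the sign. The value s = 0 stands for the vertex (1, 0, 0, 0) of the tetrahedron.\<close>
  have g_minus: "g (- y) (- z) (- w) = g y z w" for y z w
    unfolding g by algebra
  have "g y z w = 0" for y z w
  proof (rule plane_sextic_eq_zero[OF g _ _ _ _ nz])
    fix s :: complex assume s: "s \<in> {0, 1, -1, \<i>, -\<i>}"
    then have s': "s = 0 \<or> - s \<in> {1, -1, \<i>, -\<i>}" by auto
    have e: "vector [1, - s, 0, 0] \<in> klein_coordinates" "vector [1, 0, - s, 0] \<in> klein_coordinates"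
      "vector [1, 0, 0, - s] \<in> klein_coordinates"
      using s' klein_coordinates_few_nonzero(1) klein_coordinates_few_nonzero(5-7)[of "-s"]
      by (metis minus_zero)+
    show "g (a + s) b c = 0" using g_proj[OF e(1)] g_minus[of "a + s" b c] by (simp add: minus_diff_commute)
    show "g a (b + s) c = 0" using g_proj[OF e(2)] g_minus[of a "b + s" c] by (simp add: minus_diff_commute)
    show "g a b (c + s) = 0" using g_proj[OF e(3)] g_minus[of a b "c + s"] by (simp add: minus_diff_commute)
  next
    have "vector [1, 1, 1, 1] \<in> klein_coordinates"
      unfolding klein_coordinates_def by blast
    from g_proj[OF this] show "g (1 - a) (1 - b) (1 - c) = 0" by simp
  qed
  then have "cpoly_eval f (vector [x, y, z, w]) = 0" for x y z w
    by (metis proj g_def)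
  moreover have "v = vector [v $ 1, v $ 2, v $ 3, v $ 4]" for v :: "complex ^ 4"
    by (simp add: vec_eq_iff forall_4)
  ultimately have "cpoly_eval f v = 0" for v
    by metis
  then show ?thesis by (rule form_eq_zero_if_eval_eq_zero[OF f6])
qed

text \<open>This value is nonzero when a \<noteq> 0 and a^4 \<noteq> 1, so the cone is a nonzero
  form and can be scaled to match any other candidate at this point.\<close>

lemma klein_cone_at_fixed_point:
  "cpoly_eval (klein_cone a b c) (vector [0, 0, 1, 2]) = 360 * a * (1 - a^4)"
  unfolding cpoly_eval_klein_cone by algebra

text \<open>The conditions on \<open>b\<close>, \<open>c\<close> and the differences keep the
  projection of (1, 1, 1, 1) off the six lines; the last one comes from eliminating the edge
  coefficients of the plane sextic.\<close>

definition klein_general :: "complex \<Rightarrow> complex \<Rightarrow> complex \<Rightarrow> bool" where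
  "klein_general a b c \<longleftrightarrow> a \<noteq> 0 \<and> b \<noteq> 0 \<and> c \<noteq> 0 \<and> a^4 \<noteq> 1 \<and> b \<noteq> 1 \<and> c \<noteq> 1 \<and>
     a \<noteq> b \<and> b \<noteq> c \<and> a \<noteq> c \<and> a^4 + b^4 \<noteq> c^4 + 1"

lemma klein_cone_nonzero: "klein_general a b c \<Longrightarrow> klein_cone a b c \<noteq> 0"
  using klein_cone_at_fixed_point[of a b c] by (auto simp: klein_general_def)

lemma subspace_forms_through_fat: "cpoly.subspace (forms_through_fat d Z m P)"
  using subspace_forms_through[of d Z] cpoly_ideal.subspace_0[OF subspace_ideal_power]
  by (auto simp: forms_through_fat_def cpoly.subspace_def ideal_power_add ideal_power_scale)

text \<open>Evaluation at (0, 0, 1, 2) is an injective linear functional on this space and is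
  nonzero on the cone.\<close>

lemma forms_through_fat_klein:
  assumes "klein_general a b c"
  shows "forms_through_fat 6 klein_configuration 6 (proj_point (vector [1, a, b, c])) =
    cpoly.span {klein_cone a b c}" (is "?V = _")
proof
  let ?q = "vector [0, 0, 1, 2] :: complex ^ 4"
  have q: "cpoly_eval (klein_cone a b c) ?q \<noteq> 0"
    using assms by (auto simp: klein_cone_at_fixed_point klein_general_def)
  show "?V \<subseteq> cpoly.span {klein_cone a b c}"
  proof
    fix f assume f: "f \<in> ?V"
    define \<mu> where "\<mu> = cpoly_eval f ?q / cpoly_eval (klein_cone a b c) ?q"
    have "f - cpoly_scale \<mu> (klein_cone a b c) \<in> ?V"
      using f klein_cone_in_forms_through_fat subspace_forms_through_fat
      by (intro cpoly.subspace_diff cpoly.subspace_scale)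
    moreover have "cpoly_eval (f - cpoly_scale \<mu> (klein_cone a b c)) ?q = 0"
      using q by (simp add: \<mu>_def)
    ultimately have "f - cpoly_scale \<mu> (klein_cone a b c) = 0"
      by (rule klein_fat_form_eq_zero) (use assms in \<open>simp_all add: klein_general_def\<close>)
    then have "f = cpoly_scale \<mu> (klein_cone a b c)" by simp
    then show "f \<in> cpoly.span {klein_cone a b c}"
      by (simp add: cpoly.span_base cpoly.span_scale)
  qed
  show "cpoly.span {klein_cone a b c} \<subseteq> ?V"
    by (intro cpoly.span_minimal subspace_forms_through_fat) (simp add: klein_cone_in_forms_through_fat)
qed

lemma unexpected_cones_klein:
  assumes "klein_general a b c"
  shows "unexpected_cones 6 klein_configuration (proj_point (vector [1, a, b, c])) =
    {hypersurface (klein_cone a b c)}"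
proof -
  let ?P = "proj_point (vector [1, a, b, c] :: complex ^ 4)" and ?F = "klein_cone a b c"
  note F = klein_cone_nonzero[OF assms]
  note V = forms_through_fat_klein[OF assms]
  have "cpoly.independent {?F}"
    using F by simp
  then have "cpoly.dim (forms_through_fat 6 klein_configuration 6 ?P) = 1"
    unfolding V using cpoly.dim_eq_card_independent by fastforce
  \<comment> \<open>Multiplicity six imposes 56 conditions on a space of dimension at most 56, so
    the expected dimension is 0 while the actual one is 1.\<close>
  moreover have "((CARD(4) - 1) + 6 - 1) choose (CARD(4) - 1) = 56"
    by (simp add: numeral_eq_Suc)
  ultimately have unexp: "unexpected 6 klein_configuration 6 ?P"
    using dim_forms_through_klein by (simp add: unexpected_def)
  have hyp: "hypersurface (cpoly_scale k ?F) = hypersurface ?F" if "k \<noteq> 0" for k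
    unfolding hypersurface_def
  proof safe
    fix e :: complex assume "e \<noteq> 0"
    then show "\<exists>c. cpoly_scale e (cpoly_scale k ?F) = cpoly_scale c ?F \<and> c \<noteq> 0"
      using that by (intro exI[of _ "e * k"]) simp
    show "\<exists>c. cpoly_scale e ?F = cpoly_scale c (cpoly_scale k ?F) \<and> c \<noteq> 0"
      using that \<open>e \<noteq> 0\<close> by (intro exI[of _ "e / k"]) simp
  qed
  show ?thesis
  proof (intro equalityI subsetI)
    fix S assume "S \<in> unexpected_cones 6 klein_configuration ?P"
    then obtain f where "S = hypersurface f" "f \<in> cpoly.span {?F}" "f \<noteq> 0"
      unfolding unexpected_cones_def V by blast
    moreover from this obtain k where "f = cpoly_scale k ?F" "k \<noteq> 0"
      by (auto simp: cpoly.span_singleton)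
    ultimately show "S \<in> {hypersurface ?F}" by (simp add: hyp)
  next
    fix S assume "S \<in> {hypersurface ?F}"
    then show "S \<in> unexpected_cones 6 klein_configuration ?P"
      unfolding unexpected_cones_def V using F unexp cpoly.span_base[of ?F "{?F}"] by blast
  qed
qed

section \<open>From explicit inequalities to general points\<close>

lemma for_general_point_if_form:
  assumes "h \<in> forms d" "v \<noteq> 0" "cpoly_eval h v \<noteq> 0"
    and "\<And>v. cpoly_eval h v \<noteq> 0 \<Longrightarrow> Q (proj_point v)"
  shows "for_general_point Q"
  unfolding for_general_point_def
proof (intro exI conjI ballI)
  let ?U = "proj_space - {P \<in> proj_space. \<forall>f\<in>{h}. vanishes_at f P}"
  show "zariski_open ?U"
    unfolding zariski_open_def using assms(1) by (intro exI[of _ "{h}"]) auto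
  have "proj_point v \<in> ?U"
    using assms(2,3) vanishes_at_proj_point[OF assms(1)] by (auto simp: proj_space_def)
  then show "?U \<noteq> {}" by blast
  show "Q P" if "P \<in> ?U" for P
    using that assms(4) vanishes_at_proj_point[OF assms(1)] by (auto simp: proj_space_def)
qed

lemma for_general_point_klein:
  fixes Q :: "(complex ^ 4) set \<Rightarrow> bool"
  assumes "\<And>a b c. klein_general a b c \<Longrightarrow> Q (proj_point (vector [1, a, b, c]))"
  shows "for_general_point Q"
proof -
  define X :: "4 \<Rightarrow> 4 cpoly" where "X i = linear_form (axis i 1)" for i
  \<comment> \<open>The product of the homogenized inequalities of \<open>klein_general\<close>; the
    factor \<open>X 1\<close> gives the chart in which the first coordinate can be scaled to
    1.\<close>
  define h where "h = X 1 * X 2 * X 3 * X 4 * (X 2 ^ 4 - X 1 ^ 4) * (X 3 - X 1) * (X 4 - X 1)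
    * (X 2 - X 3) * (X 3 - X 4) * (X 2 - X 4) * (X 2 ^ 4 + X 3 ^ 4 - X 4 ^ 4 - X 1 ^ 4)"
  have X: "X i \<in> forms 1" "X i ^ 4 \<in> forms 4" for i
    using forms_power[of "X i" 1 4] linear_form_in_forms by (auto simp: X_def)
  have eval_X: "cpoly_eval (X i) v = v $ i" for i v
  proof -
    have "cpoly_eval (X i) v = (\<Sum>j\<in>UNIV. if j = i then v $ j else 0)"
      unfolding X_def cpoly_eval_linear_form by (intro sum.cong) (auto simp: axis_def)
    then show ?thesis by simp
  qed
  have eval_h: "cpoly_eval h v = v$1 * v$2 * v$3 * v$4 * (v$2 ^ 4 - v$1 ^ 4) * (v$3 - v$1) * (v$4 - v$1)
    * (v$2 - v$3) * (v$3 - v$4) * (v$2 - v$4) * (v$2 ^ 4 + v$3 ^ 4 - v$4 ^ 4 - v$1 ^ 4)" for v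
    by (simp add: h_def eval_X)
  show ?thesis
  \<comment> \<open>The degree is the sum of those of the factors, and (1, 2, 3, 5) is a point where
    no factor vanishes; the last one equals 16 + 81 - 625 - 1 there.\<close>
  proof (rule for_general_point_if_form[where h = h and d = 17 and v = "vector [1, 2, 3, 5]"])
    have "h \<in> forms (1 + 1 + 1 + 1 + 4 + 1 + 1 + 1 + 1 + 1 + 4)"
      unfolding h_def by (intro forms_mult forms_add forms_diff X)
    then show "h \<in> forms 17" by simp
    show "vector [1, 2, 3, 5] \<noteq> (0 :: complex ^ 4)"
      by (simp add: vec_eq_iff forall_4)
    show "cpoly_eval h (vector [1, 2, 3, 5]) \<noteq> 0"
      by (simp add: eval_h)
    fix v assume v: "cpoly_eval h v \<noteq> 0"
    define a b c where "a = v$2 / v$1" and "b = v$3 / v$1" and "c = v$4 / v$1"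
    have nz: "v$1 \<noteq> 0" using v by (auto simp: eval_h)
    then have abc: "v$2 = v$1 * a" "v$3 = v$1 * b" "v$4 = v$1 * c"
      by (simp_all add: a_def b_def c_def)
    then have v_eq: "v = v$1 *s vector [1, a, b, c]"
      by (simp add: vec_eq_iff forall_4)
    have "v$2 \<noteq> 0" "v$3 \<noteq> 0" "v$4 \<noteq> 0" "v$2 ^ 4 \<noteq> v$1 ^ 4" "v$3 \<noteq> v$1" "v$4 \<noteq> v$1"
      "v$2 \<noteq> v$3" "v$3 \<noteq> v$4" "v$2 \<noteq> v$4" "v$2 ^ 4 + v$3 ^ 4 - v$4 ^ 4 - v$1 ^ 4 \<noteq> 0"
      using v unfolding eval_h by simp_all
    moreover have "v$2 ^ 4 + v$3 ^ 4 - v$4 ^ 4 - v$1 ^ 4 = v$1 ^ 4 * (a^4 + b^4 - (c^4 + 1))"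
      unfolding abc by algebra
    ultimately have "klein_general a b c"
      unfolding klein_general_def by (auto simp: abc power_mult_distrib)
    then have "Q (proj_point (vector [1, a, b, c]))" by (rule assms)
    then show "Q (proj_point v)"
      using v_eq proj_point_scale[OF nz] by metis
  qed
qed

theorem theorem4p3:
  shows "unexpected_cone_property 6 klein_configuration \<and>
    for_general_point (\<lambda>P. \<exists>!S. S \<in> unexpected_cones 6 klein_configuration P)"
  unfolding unexpected_cone_property_def
  by (auto intro!: for_general_point_klein simp: unexpected_cones_klein)

end
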